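(* Let $\Sigma$ be a finite monoid and let $W$ be a real vector space of dimension $d$ with basis $\{b_1,\dots,b_d\}$. Suppose $\mathcal N^1=\bigoplus_{\sigma\in\Sigma}\mathbb R$ decomposes as $\mathcal N^1=Y_1\oplus\cdots\oplus Y_s$ into indecomposable subrepresentations with respect to $\{A^1_\sigma\}_{\sigma\in\Sigma}$. Then $$\mathcal N^D\;\cong\;\mathcal N^1\otimes W\;=\;\bigoplus_{i=1}^s\bigoplus_{j=1}^d Y_i\otimes\langle b_j\rangle\;\cong\;\bigoplus_{i=1}^s Y_i^{\,d}$$ as a decomposition into indecomposable subrepresentations with respect to $\{A^1_\sigma\otimes \mathbb 1_W\}_{\sigma\in\Sigma}$.
   Context: For a finite-dimensional real vector space $V$, the right regular representation of $\Sigma$ on $\bigoplus_{\sigma\in\Sigma}V$ is $(A_\sigma v)_\tau=v_{\tau\sigma}$ for $\sigma,\tau\in\Sigma$. For $V=\mathbb R$ the space is denoted $\mathcal N^1$ and the maps $A^1_\sigma$; for $V=W$ the space is denoted $\mathcal N^D$ and the maps $A^D_\sigma$. A subrepresentation is a linear subspace invariant under all representation maps; it is indecomposable if it is nonzero and is not a direct sum of two nonzero subrepresentations. $\cong$ denotes isomorphism of $\Sigma$-representations (linear bijection intertwining the actions), $\sigma$ acts on $\mathcal N^1\otimes W$ by $A^1_\sigma\otimes\mathbb 1_W$, $\langle b\rangle$ is the linear span, and $Y^d$ is the direct sum of $d$ copies of $Y$. The first isomorphism is the identification of $(x_\sigma)_{\sigma}\otimes w$ with $(x_\sigma w)_\sigma$.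 *)

theory Defs
  imports "HOL-Analysis.Analysis" "HOL-Analysis.Finite_Function_Topology"
begin

section \<open>The tensor product of two real vector spaces\<close>

text \<open>
  The free real vector space on \<open>'a \<times> 'b\<close> is \<open>('a \<times> 'b) \<Rightarrow>\<^sub>0 real\<close>; the tensor product is
  its quotient by the span of the bilinearity relations.
\<close>

definition tensor_relations :: "(('a::real_vector \<times> 'b::real_vector) \<Rightarrow>\<^sub>0 real) set" where
  "tensor_relations =
     {Poly_Mapping.single (u + u', w) 1
        - (Poly_Mapping.single (u, w) 1 + Poly_Mapping.single (u', w) 1) | u u' w. True}
   \<union> {Poly_Mapping.single (u, w + w') 1
        - (Poly_Mapping.single (u, w) 1 + Poly_Mapping.single (u, w') 1) | u w w'. True}
   \<union> {Poly_Mapping.single (c *\<^sub>R u, w) 1 - c *\<^sub>R Poly_Mapping.single (u, w) 1 | c u w. True}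
   \<union> {Poly_Mapping.single (u, c *\<^sub>R w) 1 - c *\<^sub>R Poly_Mapping.single (u, w) 1 | c u w. True}"

quotient_type (overloaded) ('a, 'b) tensor =
  "('a::real_vector \<times> 'b::real_vector) \<Rightarrow>\<^sub>0 real"
  / "\<lambda>p q. p - q \<in> span tensor_relations"
proof (rule equivpI)
  show "reflp (\<lambda>p q. p - q \<in> span (tensor_relations :: (('a \<times> 'b) \<Rightarrow>\<^sub>0 real) set))"
    by (auto intro!: reflpI simp: span_zero)
  show "symp (\<lambda>p q. p - q \<in> span (tensor_relations :: (('a \<times> 'b) \<Rightarrow>\<^sub>0 real) set))"
    by (rule sympI) (metis minus_diff_eq span_neg)
  show "transp (\<lambda>p q. p - q \<in> span (tensor_relations :: (('a \<times> 'b) \<Rightarrow>\<^sub>0 real) set))"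
  proof (rule transpI)
    fix p q r :: "('a \<times> 'b) \<Rightarrow>\<^sub>0 real"
    assume "p - q \<in> span tensor_relations" "q - r \<in> span tensor_relations"
    then have "(p - q) + (q - r) \<in> span tensor_relations" by (rule span_add)
    then show "p - r \<in> span tensor_relations" by simp
  qed
qed

instantiation tensor :: (real_vector, real_vector) real_vector
begin

lift_definition zero_tensor :: "('a, 'b) tensor" is 0 .

lift_definition plus_tensor :: "('a, 'b) tensor \<Rightarrow> ('a, 'b) tensor \<Rightarrow> ('a, 'b) tensor"
  is "(+)"
  by (metis add_diff_add span_add)

lift_definition uminus_tensor :: "('a, 'b) tensor \<Rightarrow> ('a, 'b) tensor" is uminus
  by (metis minus_diff_minus span_neg)

lift_definition minus_tensor :: "('a, 'b) tensor \<Rightarrow> ('a, 'b) tensor \<Rightarrow> ('a, 'b) tensor"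
  is "(-)"
proof -
  fix p p' q q' :: "('a \<times> 'b) \<Rightarrow>\<^sub>0 real"
  assume "p - p' \<in> span tensor_relations" "q - q' \<in> span tensor_relations"
  then have "(p - p') - (q - q') \<in> span tensor_relations" by (rule span_diff)
  then show "(p - q) - (p' - q') \<in> span tensor_relations" by (simp add: algebra_simps)
qed

lift_definition scaleR_tensor :: "real \<Rightarrow> ('a, 'b) tensor \<Rightarrow> ('a, 'b) tensor" is scaleR
  by (metis scaleR_diff_right span_scale)

instance
  by standard (transfer; simp add: algebra_simps span_zero)+

end

lift_definition pure_tensor ::
    "'a::real_vector \<Rightarrow> 'b::real_vector \<Rightarrow> ('a, 'b) tensor"  (infixl "\<otimes>" 70)
  is "\<lambda>u w. Poly_Mapping.single (u, w) 1" .

text \<open>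
  Meaningful for bilinear \<open>\<beta>\<close> only; existence and uniqueness of the linear map (the universal
  property) is \<open>tensor_universal\<close> below.
\<close>

definition tensor_lift ::
    "('a::real_vector \<Rightarrow> 'b::real_vector \<Rightarrow> 'c::real_vector) \<Rightarrow> ('a, 'b) tensor \<Rightarrow> 'c" where
  "tensor_lift \<beta> = (THE h. linear h \<and> (\<forall>u w. h (u \<otimes> w) = \<beta> u w))"

definition tensor_map ::
    "('a::real_vector \<Rightarrow> 'c::real_vector) \<Rightarrow> ('b::real_vector \<Rightarrow> 'd::real_vector)
      \<Rightarrow> ('a, 'b) tensor \<Rightarrow> ('c, 'd) tensor" where
  "tensor_map f g = tensor_lift (\<lambda>u w. f u \<otimes> g w)"

text \<open>
  The image of \<open>U \<otimes> V\<close> in the tensor product of the ambient spaces; over a field the canonical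
  map is injective, so this is the tensor product of the subspaces \<open>U\<close> and \<open>V\<close>.
\<close>

definition tensor_sub ::
    "'a::real_vector set \<Rightarrow> 'b::real_vector set \<Rightarrow> ('a, 'b) tensor set" where
  "tensor_sub U V = span {u \<otimes> w | u w. u \<in> U \<and> w \<in> V}"

lemma bilinear_pure_tensor: "bilinear (\<otimes>)"
proof -
  have 1: "(u + u') \<otimes> w = u \<otimes> w + u' \<otimes> w" for u u' :: 'a and w :: 'b
    by transfer (rule span_base, unfold tensor_relations_def, blast)
  have 2: "u \<otimes> (w + w') = u \<otimes> w + u \<otimes> w'" for u :: 'a and w w' :: 'b
    by transfer (rule span_base, unfold tensor_relations_def, blast)
  have 3: "(c *\<^sub>R u) \<otimes> w = c *\<^sub>R (u \<otimes> w)" for c and u :: 'a and w :: 'b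
    by transfer (rule span_base, unfold tensor_relations_def, blast)
  have 4: "u \<otimes> (c *\<^sub>R w) = c *\<^sub>R (u \<otimes> w)" for c and u :: 'a and w :: 'b
    by transfer (rule span_base, unfold tensor_relations_def, blast)
  show ?thesis
    by (simp add: bilinear_def linear_iff 1 2 3 4)
qed

lemma span_single: "span (range (\<lambda>k. Poly_Mapping.single k (1::real))) = UNIV"
proof -
  have "p \<in> span (range (\<lambda>k. Poly_Mapping.single k (1::real)))" for p :: "'k \<Rightarrow>\<^sub>0 real"
  proof -
    have "p = (\<Sum>k\<in>Poly_Mapping.keys p. Poly_Mapping.lookup p k *\<^sub>R Poly_Mapping.single k 1)"
      by (rule poly_mapping_eqI)
        (simp add: lookup_sum scaleR_poly_mapping_def lookup_single when_def in_keys_iff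
          if_distrib sum.delta cong: if_cong)
    also have "\<dots> \<in> span (range (\<lambda>k. Poly_Mapping.single k (1::real)))"
      by (intro span_sum span_scale span_base) auto
    finally show ?thesis .
  qed
  then show ?thesis by blast
qed

lemma linear_abs_tensor: "linear abs_tensor"
  by (simp add: linear_iff plus_tensor.abs_eq scaleR_tensor.abs_eq)

lemma span_pure_tensor: "span {u \<otimes> w | u w. True} = UNIV"
proof -
  have "{u \<otimes> w | u w. True} = abs_tensor ` range (\<lambda>k::'a \<times> 'b. Poly_Mapping.single k 1)"
    by (force simp: pure_tensor.abs_eq image_iff)
  then have "span {u \<otimes> w | u w. True} = abs_tensor ` (UNIV :: (('a \<times> 'b) \<Rightarrow>\<^sub>0 real) set)"
    by (simp only: linear_span_image[OF linear_abs_tensor] span_single)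
  also have "\<dots> = UNIV"
    by (rule surjI, rule Quotient3_abs_rep[OF Quotient3_tensor])
  finally show ?thesis .
qed

lemma tensor_universal:
  assumes "bilinear \<beta>"
  shows "\<exists>!h. linear h \<and> (\<forall>u w. h (u \<otimes> w) = \<beta> u w)"
proof (rule ex_ex1I)
  define F where "F p = (\<Sum>k\<in>Poly_Mapping.keys p. Poly_Mapping.lookup p k *\<^sub>R \<beta> (fst k) (snd k))"
    for p
  have F_eq: "F p = (\<Sum>k\<in>K. Poly_Mapping.lookup p k *\<^sub>R \<beta> (fst k) (snd k))"
    if "finite K" "Poly_Mapping.keys p \<subseteq> K" for p K
    unfolding F_def using that
    by (intro sum.mono_neutral_left) (auto simp: in_keys_iff)
  have F_add: "F (p + q) = F p + F q" for p q
  proof -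
    let ?K = "Poly_Mapping.keys p \<union> Poly_Mapping.keys q"
    show ?thesis
      using F_eq[of ?K "p + q"] F_eq[of ?K p] F_eq[of ?K q] Poly_Mapping.keys_add[of p q]
      by (simp add: lookup_add scaleR_add_left sum.distrib)
  qed
  have lookup_scaleR: "Poly_Mapping.lookup (c *\<^sub>R p) k = c * Poly_Mapping.lookup p k"
    for c and p :: "('a \<times> 'b) \<Rightarrow>\<^sub>0 real" and k
    by (simp add: scaleR_poly_mapping_def)
  have F_scale: "F (c *\<^sub>R p) = c *\<^sub>R F p" for c p
    using F_eq[of "Poly_Mapping.keys p" "c *\<^sub>R p"] F_eq[of "Poly_Mapping.keys p" p]
    by (auto simp: lookup_scaleR scaleR_sum_right in_keys_iff subset_iff)
  have F_linear: "linear F" by (simp add: linear_iff F_add F_scale)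
  have F_single: "F (Poly_Mapping.single k 1) = \<beta> (fst k) (snd k)" for k
    by (simp add: F_def)
  have "F r = 0" if "r \<in> tensor_relations" for r
    using that assms unfolding tensor_relations_def
    by (auto simp: linear_diff[OF F_linear] F_add F_scale F_single
        bilinear_ladd bilinear_radd bilinear_lmul bilinear_rmul)
  then have F_null: "F r = 0" if "r \<in> span tensor_relations" for r
    using that linear_eq_0_on_span[OF F_linear] by blast
  have F_resp: "F p = F q" if "p - q \<in> span tensor_relations" for p q
    using F_null[OF that] by (simp add: linear_diff[OF F_linear])
  have F_rep: "F (rep_tensor (abs_tensor p)) = F p" for p
  proof (rule F_resp)
    have "abs_tensor (rep_tensor (abs_tensor p)) = abs_tensor p"
      by (rule Quotient3_abs_rep[OF Quotient3_tensor])
    then show "rep_tensor (abs_tensor p) - p \<in> span tensor_relations"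
      by (simp only: tensor.abs_eq_iff)
  qed
  define h where "h t = F (rep_tensor t)" for t
  have h_abs: "h (abs_tensor p) = F p" for p
    by (simp add: h_def F_rep)
  have "linear h"
  proof (rule linearI)
    fix x y :: "('a, 'b) tensor" and c :: real
    obtain p q where [simp]: "x = abs_tensor p" "y = abs_tensor q"
      using Quotient3_abs_rep[OF Quotient3_tensor, of x]
        Quotient3_abs_rep[OF Quotient3_tensor, of y] by metis
    show "h (x + y) = h x + h y" by (simp add: plus_tensor.abs_eq h_abs F_add)
    show "h (c *\<^sub>R x) = c *\<^sub>R h x" by (simp add: scaleR_tensor.abs_eq h_abs F_scale)
  qed
  moreover have "\<forall>u w. h (u \<otimes> w) = \<beta> u w"
    by (simp add: pure_tensor.abs_eq h_abs F_single)
  ultimately show "\<exists>h. linear h \<and> (\<forall>u w. h (u \<otimes> w) = \<beta> u w)" by blast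
next
  fix h h' :: "('a, 'b) tensor \<Rightarrow> 'c"
  assume h: "linear h \<and> (\<forall>u w. h (u \<otimes> w) = \<beta> u w)"
    and h': "linear h' \<and> (\<forall>u w. h' (u \<otimes> w) = \<beta> u w)"
  show "h = h'"
  proof
    fix t :: "('a, 'b) tensor"
    have "t \<in> span {u \<otimes> w | u w. True}"
      by (simp only: span_pure_tensor UNIV_I)
    then show "h t = h' t"
      by (rule linear_eq_on_span[of h h', rotated 3]) (use h h' in auto)
  qed
qed

lemma tensor_lift:
  assumes "bilinear \<beta>"
  shows "linear (tensor_lift \<beta>)" and "tensor_lift \<beta> (u \<otimes> w) = \<beta> u w"
  using theI'[OF tensor_universal[OF assms], folded tensor_lift_def] by simp_all

lemma tensor_map:
  assumes "linear f" "linear g"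
  shows "linear (tensor_map f g)" and "tensor_map f g (u \<otimes> w) = f u \<otimes> g w"
proof -
  have "bilinear (\<lambda>u w. f u \<otimes> g w)"
    unfolding bilinear_def linear_iff
    by (simp add: linear_add linear_scale assms
        bilinear_ladd[OF bilinear_pure_tensor] bilinear_radd[OF bilinear_pure_tensor]
        bilinear_lmul[OF bilinear_pure_tensor] bilinear_rmul[OF bilinear_pure_tensor])
  from tensor_lift[OF this]
  show "linear (tensor_map f g)" and "tensor_map f g (u \<otimes> w) = f u \<otimes> g w"
    by (simp_all add: tensor_map_def)
qed


section \<open>Subrepresentations, direct sums, isomorphisms\<close>

definition subrep :: "('s \<Rightarrow> 'v::real_vector \<Rightarrow> 'v) \<Rightarrow> 'v set \<Rightarrow> bool" where
  "subrep \<rho> U \<longleftrightarrow> subspace U \<and> (\<forall>\<sigma>. \<forall>u\<in>U. \<rho> \<sigma> u \<in> U)"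

definition indecomposable :: "('s \<Rightarrow> 'v::real_vector \<Rightarrow> 'v) \<Rightarrow> 'v set \<Rightarrow> bool" where
  "indecomposable \<rho> U \<longleftrightarrow> subrep \<rho> U \<and> U \<noteq> {0} \<and>
     \<not> (\<exists>U1 U2. subrep \<rho> U1 \<and> subrep \<rho> U2 \<and> U1 \<noteq> {0} \<and> U2 \<noteq> {0} \<and>
           U = {x + y | x y. x \<in> U1 \<and> y \<in> U2} \<and> U1 \<inter> U2 = {0})"

text \<open>\<open>V\<close> is the internal direct sum of the subspaces \<open>U i\<close>, \<open>i \<in> I\<close> (\<open>I\<close> finite).\<close>

definition internal_direct_sum :: "'i set \<Rightarrow> ('i \<Rightarrow> 'v::real_vector set) \<Rightarrow> 'v set \<Rightarrow> bool" where
  "internal_direct_sum I U V \<longleftrightarrow> (\<forall>i\<in>I. subspace (U i)) \<and>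
     bij_betw (\<lambda>u. \<Sum>i\<in>I. u i) (Pi\<^sub>E I U) V"

text \<open>
  The external direct sum of the \<open>U i\<close>, \<open>i \<in> I\<close>, realised inside the finitely supported functions;
  a representation acts on it componentwise.
\<close>

definition external_direct_sum :: "'i set \<Rightarrow> ('i \<Rightarrow> 'v::real_vector set) \<Rightarrow> ('i \<Rightarrow>\<^sub>0 'v) set" where
  "external_direct_sum I U =
     {f. Poly_Mapping.keys f \<subseteq> I \<and> (\<forall>i\<in>I. Poly_Mapping.lookup f i \<in> U i)}"

definition sum_rep ::
    "('s \<Rightarrow> 'v::real_vector \<Rightarrow> 'v) \<Rightarrow> 's \<Rightarrow> ('i \<Rightarrow>\<^sub>0 'v) \<Rightarrow> ('i \<Rightarrow>\<^sub>0 'v)" where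
  "sum_rep \<rho> \<sigma> = Poly_Mapping.map (\<rho> \<sigma>)"

definition power_space :: "nat \<Rightarrow> 'v::real_vector set \<Rightarrow> (nat \<Rightarrow>\<^sub>0 'v) set" where
  "power_space d Y = external_direct_sum {1..d} (\<lambda>_. Y)"

text \<open>
  \<open>\<phi>\<close> is an isomorphism from the subrepresentation \<open>U\<close> of \<open>\<rho>\<close> onto the subrepresentation \<open>U'\<close>
  of \<open>\<rho>'\<close>; its values outside \<open>U\<close> are irrelevant.
\<close>

definition rep_iso ::
    "('s \<Rightarrow> 'v::real_vector \<Rightarrow> 'v) \<Rightarrow> 'v set
      \<Rightarrow> ('s \<Rightarrow> 'w::real_vector \<Rightarrow> 'w) \<Rightarrow> 'w set \<Rightarrow> ('v \<Rightarrow> 'w) \<Rightarrow> bool" where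
  "rep_iso \<rho> U \<rho>' U' \<phi> \<longleftrightarrow>
     subrep \<rho> U \<and> subrep \<rho>' U' \<and> bij_betw \<phi> U U' \<and>
     (\<forall>x\<in>U. \<forall>y\<in>U. \<phi> (x + y) = \<phi> x + \<phi> y) \<and>
     (\<forall>c. \<forall>x\<in>U. \<phi> (c *\<^sub>R x) = c *\<^sub>R \<phi> x) \<and>
     (\<forall>\<sigma>. \<forall>x\<in>U. \<phi> (\<rho> \<sigma> x) = \<rho>' \<sigma> (\<phi> x))"


section \<open>The right regular representation\<close>

text \<open>
  Both \<open>\<N>\<^sup>1\<close> (\<open>'v = real\<close>) and \<open>\<N>\<^sup>D\<close> (\<open>'v = W\<close>) are the space \<open>('v, 's) vec\<close>, that is
  \<open>'v ^ 's\<close>, of families indexed by the monoid \<open>'s\<close>.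
\<close>

definition right_reg ::
    "'s::{finite, monoid_mult} \<Rightarrow> ('v::real_vector, 's) vec \<Rightarrow> ('v, 's) vec" where
  "right_reg \<sigma> v = (\<chi> \<tau>. v $ (\<tau> * \<sigma>))"

lemma linear_right_reg: "linear (right_reg \<sigma>)"
  by (simp add: linear_iff right_reg_def vec_eq_iff)

lemma right_reg_one: "right_reg 1 v = v"
  by (simp add: right_reg_def vec_eq_iff)

lemma right_reg_mult: "right_reg (\<sigma> * \<tau>) v = right_reg \<sigma> (right_reg \<tau> v)"
  by (simp add: right_reg_def vec_eq_iff mult.assoc)

text \<open>The action \<open>\<sigma> \<mapsto> A\<^sup>1\<^sub>\<sigma> \<otimes> 1\<^sub>W\<close> on \<open>\<N>\<^sup>1 \<otimes> W\<close>.\<close>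

definition tensor_right_reg ::
    "'s::{finite, monoid_mult} \<Rightarrow> ((real, 's) vec, 'w::real_vector) tensor
      \<Rightarrow> ((real, 's) vec, 'w) tensor" where
  "tensor_right_reg \<sigma> = tensor_map (right_reg \<sigma>) id"

lemma linear_tensor_right_reg: "linear (tensor_right_reg \<sigma>)"
  by (simp add: tensor_right_reg_def tensor_map(1) linear_right_reg linear_id)

lemma tensor_right_reg_pure: "tensor_right_reg \<sigma> (x \<otimes> w) = right_reg \<sigma> x \<otimes> w"
  by (simp add: tensor_right_reg_def tensor_map(2) linear_right_reg linear_id)

end

theory Submission
  imports Defs
begin

text \<open>
  Expanding the second factor in the basis gives every tensor unique coordinates
  \<open>t = (\<Sum>j. C j t \<otimes> b j)\<close>, and each \<open>C j\<close> intertwines the two actions. Composing with the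
  (equivariant) projections \<open>P i\<close> onto the \<open>Y i\<close> yields the projections
  \<open>t \<mapsto> P i (C j t) \<otimes> b j\<close> onto \<open>Y i \<otimes> \<langle>b j\<rangle>\<close>. Each of these summands is isomorphic to \<open>Y i\<close> via
  \<open>y \<mapsto> y \<otimes> b j\<close>, hence indecomposable.
\<close>

section \<open>Direct sums and indecomposable subrepresentations\<close>

text \<open>For finite \<open>I\<close> these are orthogonal idempotents with sum the identity.
  Directness becomes a set of equations, which for the tensor product are checked by computing on
  pure tensors, whereas bijectivity of the summation map is awkward there.\<close>

definition projection_family ::
    "'i set \<Rightarrow> ('i \<Rightarrow> 'v::real_vector set) \<Rightarrow> ('i \<Rightarrow> 'v \<Rightarrow> 'v) \<Rightarrow> bool" where
  "projection_family I U P \<longleftrightarrow>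
     (\<forall>i\<in>I. subspace (U i) \<and> linear (P i) \<and> (\<forall>x. P i x \<in> U i)) \<and>
     (\<forall>x. (\<Sum>i\<in>I. P i x) = x) \<and>
     (\<forall>i\<in>I. \<forall>k\<in>I. \<forall>y\<in>U k. P i y = (if i = k then y else 0))"

text \<open>Members of \<open>Pi\<^sub>E I U\<close> are fixed to \<open>undefined\<close> off
  \<open>I\<close>, so injectivity speaks only of restrictions. This version frees later arguments
  from that constraint on the families.\<close>

lemma internal_direct_sum_unique:
  assumes "internal_direct_sum I U V" "\<And>i. i \<in> I \<Longrightarrow> u i \<in> U i" "\<And>i. i \<in> I \<Longrightarrow> v i \<in> U i"
    and "(\<Sum>i\<in>I. u i) = (\<Sum>i\<in>I. v i)" "i \<in> I"
  shows "u i = v i"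
proof -
  have inj: "inj_on (\<lambda>u. \<Sum>i\<in>I. u i) (Pi\<^sub>E I U)"
    using assms(1) by (simp add: internal_direct_sum_def bij_betw_def)
  have "restrict u I = restrict v I"
    by (rule inj_onD[OF inj]) (use assms in auto)
  then show ?thesis
    using assms(5) by (metis restrict_apply')
qed

text \<open>Choice picks a decomposition of every vector. Linearity and the values on the summands
  then follow from uniqueness, since in each case two decompositions of the same vector are
  compared.\<close>

lemma internal_direct_sum_projections:
  assumes ids: "internal_direct_sum I U UNIV" and fin: "finite I"
  obtains P where "projection_family I U P"
proof -
  have sub: "subspace (U i)" if "i \<in> I" for i
    using ids that by (simp add: internal_direct_sum_def)
  have surj: "(\<lambda>u. \<Sum>i\<in>I. u i) ` Pi\<^sub>E I U = UNIV"
    using ids by (simp add: internal_direct_sum_def bij_betw_def)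
  have "\<forall>x. \<exists>u. u \<in> Pi\<^sub>E I U \<and> (\<Sum>i\<in>I. u i) = x"
    using surj by (metis (mono_tags, lifting) UNIV_I image_iff)
  then obtain p where p: "\<And>x. p x \<in> Pi\<^sub>E I U" "\<And>x. (\<Sum>i\<in>I. p x i) = x"
    by metis
  have mem: "p x i \<in> U i" if "i \<in> I" for x i
    using p(1)[of x] that by auto
  note unique = internal_direct_sum_unique[OF ids]
  have "linear (\<lambda>x. p x i)" if "i \<in> I" for i
  proof (rule linearI)
    show "p (x + y) i = p x i + p y i" for x y
      by (rule unique[of "p (x + y)" "\<lambda>i. p x i + p y i"])
        (auto simp: mem that sub subspace_add sum.distrib p(2))
    show "p (c *\<^sub>R x) i = c *\<^sub>R p x i" for c x
      by (rule unique[of "p (c *\<^sub>R x)" "\<lambda>i. c *\<^sub>R p x i"])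
        (auto simp: mem that sub subspace_scale scaleR_sum_right[symmetric] p(2))
  qed
  moreover have "p y i = (if i = k then y else 0)" if "i \<in> I" "k \<in> I" "y \<in> U k" for i k y
    by (rule unique[of "p y" "\<lambda>i. if i = k then y else 0"])
      (auto simp: mem that sub subspace_0 p(2) fin)
  ultimately have "projection_family I U (\<lambda>i x. p x i)"
    by (simp add: projection_family_def sub mem p(2))
  then show ?thesis by (rule that)
qed

text \<open>Applying \<open>P i\<close> to a sum of members of the \<open>U k\<close> recovers the
  summand at \<open>i\<close>, which gives injectivity; the projections of \<open>x\<close> sum to
  \<open>x\<close>, which gives surjectivity.\<close>

lemma projection_family_internal_direct_sum:
  assumes P: "projection_family I U P" and fin: "finite I"
  shows "internal_direct_sum I U UNIV"
proof -
  have lin: "linear (P i)" if "i \<in> I" for i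
    using P that by (simp add: projection_family_def)
  have coord: "P i (\<Sum>k\<in>I. u k) = u i" if "u \<in> Pi\<^sub>E I U" "i \<in> I" for u i
  proof -
    have "P i (\<Sum>k\<in>I. u k) = (\<Sum>k\<in>I. P i (u k))"
      by (rule linear_sum[OF lin[OF that(2)]])
    also have "\<dots> = (\<Sum>k\<in>I. if i = k then u k else 0)"
    proof (intro sum.cong refl)
      fix k assume "k \<in> I"
      then have "u k \<in> U k" using that(1) by auto
      with \<open>k \<in> I\<close> P that(2) show "P i (u k) = (if i = k then u k else 0)"
        unfolding projection_family_def by blast
    qed
    finally show ?thesis using fin that by simp
  qed
  have "inj_on (\<lambda>u. \<Sum>i\<in>I. u i) (Pi\<^sub>E I U)"
  proof (rule inj_onI)
    fix u v assume "u \<in> Pi\<^sub>E I U" "v \<in> Pi\<^sub>E I U" "(\<Sum>i\<in>I. u i) = (\<Sum>i\<in>I. v i)"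
    then show "u = v" by (metis PiE_ext coord)
  qed
  moreover have "x \<in> (\<lambda>u. \<Sum>i\<in>I. u i) ` Pi\<^sub>E I U" for x
    by (rule image_eqI[of _ _ "\<lambda>i\<in>I. P i x"])
      (use P in \<open>auto simp: projection_family_def\<close>)
  ultimately show ?thesis
    using P by (auto simp: internal_direct_sum_def bij_betw_def projection_family_def)
qed

text \<open>Both sides are the component at \<open>i\<close> of a decomposition of
  \<open>f x\<close>, because \<open>f\<close> preserves every summand. It is meant for the action
  maps and yields equivariance of the projections.\<close>

lemma projection_family_commute:
  assumes P: "projection_family I U P" and fin: "finite I" and f: "linear f"
    and inv: "\<And>i u. i \<in> I \<Longrightarrow> u \<in> U i \<Longrightarrow> f u \<in> U i" and i: "i \<in> I"
  shows "P i (f x) = f (P i x)"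
proof (rule internal_direct_sum_unique[OF projection_family_internal_direct_sum[OF P fin],
      of "\<lambda>i. P i (f x)" "\<lambda>i. f (P i x)"])
  show "(\<Sum>i\<in>I. P i (f x)) = (\<Sum>i\<in>I. f (P i x))"
    using P by (simp add: linear_sum[OF f, symmetric] projection_family_def)
qed (use P inv i in \<open>auto simp: projection_family_def\<close>)

text \<open>A splitting of \<open>U'\<close> pulls back along \<open>\<phi>\<close> to a splitting
  of \<open>U\<close>, with both summands still nonzero.\<close>

lemma indecomposable_rep_iso:
  assumes iso: "rep_iso \<rho> U \<rho>' U' \<phi>" and ind: "indecomposable \<rho> U"
  shows "indecomposable \<rho>' U'"
proof -
  have U: "subrep \<rho> U" and U': "subrep \<rho>' U'" and bij: "bij_betw \<phi> U U'"
    and add: "\<And>x y. x \<in> U \<Longrightarrow> y \<in> U \<Longrightarrow> \<phi> (x + y) = \<phi> x + \<phi> y"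
    and scale: "\<And>c x. x \<in> U \<Longrightarrow> \<phi> (c *\<^sub>R x) = c *\<^sub>R \<phi> x"
    and act: "\<And>\<sigma> x. x \<in> U \<Longrightarrow> \<phi> (\<rho> \<sigma> x) = \<rho>' \<sigma> (\<phi> x)"
    using iso by (auto simp: rep_iso_def)
  have sU: "subspace U" and inv: "\<And>\<sigma> x. x \<in> U \<Longrightarrow> \<rho> \<sigma> x \<in> U"
    using U by (auto simp: subrep_def)
  have inj: "inj_on \<phi> U" and img: "\<phi> ` U = U'"
    using bij by (auto simp: bij_betw_def)
  have zero: "\<phi> 0 = 0" using scale[of 0 0] subspace_0[OF sU] by simp
  have pull: "subrep \<rho> {x \<in> U. \<phi> x \<in> T}" if "subrep \<rho>' T" for T
    using that sU
    by (auto simp: subrep_def subspace_def zero add scale act inv)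
  have push: "\<phi> ` {x \<in> U. \<phi> x \<in> T} = T" if "T \<subseteq> U'" for T
    using that img by blast
  \<comment> \<open>By \<open>push\<close>, \<open>\<phi>\<close> maps the preimage onto
    \<open>T\<close>, so a zero preimage would force \<open>T = {0}\<close>.\<close>
  have nz: "{x \<in> U. \<phi> x \<in> T} \<noteq> {0}" if "T \<subseteq> U'" "T \<noteq> {0}" for T
    using push[OF that(1)] that(2) zero by fastforce
  have "U' \<noteq> {0}"
  proof
    assume "U' = {0}"
    then have "\<phi> x = \<phi> 0" if "x \<in> U" for x using img zero that by auto
    then have "U = {0}" using inj subspace_0[OF sU] by (auto dest: inj_onD)
    then show False using ind by (simp add: indecomposable_def)
  qed
  moreover have False
    if T: "subrep \<rho>' T1" "subrep \<rho>' T2" "T1 \<noteq> {0}" "T2 \<noteq> {0}"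
      and eq: "U' = {x + y | x y. x \<in> T1 \<and> y \<in> T2}" and int: "T1 \<inter> T2 = {0}" for T1 T2
  proof -
    let ?U1 = "{x \<in> U. \<phi> x \<in> T1}" and ?U2 = "{x \<in> U. \<phi> x \<in> T2}"
    have "0 \<in> T1" "0 \<in> T2" using T by (auto simp: subrep_def subspace_0)
    then have sub: "T1 \<subseteq> U'" "T2 \<subseteq> U'"
      unfolding eq by (force intro: exI[of _ 0])+
    have "U = {x + y | x y. x \<in> ?U1 \<and> y \<in> ?U2}"
    proof (intro subset_antisym subsetI)
      fix u assume u: "u \<in> U"
      then obtain x' y' where xy': "x' \<in> T1" "y' \<in> T2" "\<phi> u = x' + y'"
        using img eq by blast
      then obtain x y where xy: "x \<in> U" "y \<in> U" "x' = \<phi> x" "y' = \<phi> y"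
        using sub img by blast
      then have "\<phi> u = \<phi> (x + y)" using xy' add by simp
      then have "u = x + y" using inj u xy sU by (auto dest: inj_onD simp: subspace_add)
      then show "u \<in> {x + y | x y. x \<in> ?U1 \<and> y \<in> ?U2}" using xy xy' by blast
    qed (auto simp: sU subspace_add)
    moreover have "?U1 \<inter> ?U2 = {0}"
    proof -
      have "x = 0" if "x \<in> U" "\<phi> x \<in> T1" "\<phi> x \<in> T2" for x
      proof (rule inj_onD[OF inj])
        show "\<phi> x = \<phi> 0" using that int zero by auto
      qed (use that sU subspace_0 in auto)
      then show ?thesis
        using zero \<open>0 \<in> T1\<close> \<open>0 \<in> T2\<close> subspace_0[OF sU] by auto
    qed
    ultimately show False
      using ind pull[OF T(1)] pull[OF T(2)] nz[OF sub(1) T(3)] nz[OF sub(2) T(4)]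
      unfolding indecomposable_def by blast
  qed
  ultimately show ?thesis
    using U' unfolding indecomposable_def by blast
qed


section \<open>Tensor products\<close>

lemma tensor_linear_eqI:
  assumes "linear f" "linear g" "\<And>u w. f (u \<otimes> w) = g (u \<otimes> w)"
  shows "f t = g t"
proof (rule linear_eq_on_span[OF assms(1,2)])
  show "t \<in> span {u \<otimes> w | u w. True}" by (simp only: span_pure_tensor UNIV_I)
qed (use assms(3) in auto)

lemma linear_pure_tensor_left: "linear (\<lambda>u. u \<otimes> w)"
  and linear_pure_tensor_right: "linear (\<lambda>w. u \<otimes> w)"
  using bilinear_pure_tensor by (auto simp: bilinear_def)

text \<open>A scalar on \<open>w\<close> can be moved to the left factor, so every generator already
  lies in the image of \<open>U\<close>, and this image is a subspace.\<close>

lemma tensor_sub_line: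
  assumes "subspace U"
  shows "tensor_sub U (span {w}) = (\<lambda>u. u \<otimes> w) ` U"
proof
  have sub: "subspace ((\<lambda>u. u \<otimes> w) ` U)"
    by (rule linear_subspace_image[OF linear_pure_tensor_left assms])
  have "u \<otimes> (c *\<^sub>R w) \<in> (\<lambda>u. u \<otimes> w) ` U" if "u \<in> U" for u c
    using subspace_scale[OF sub imageI[OF that], of c]
    by (simp add: bilinear_rmul[OF bilinear_pure_tensor])
  then show "tensor_sub U (span {w}) \<subseteq> (\<lambda>u. u \<otimes> w) ` U"
    unfolding tensor_sub_def by (intro span_minimal sub) (auto simp: span_singleton)
  show "(\<lambda>u. u \<otimes> w) ` U \<subseteq> tensor_sub U (span {w})"
    unfolding tensor_sub_def by (auto intro!: span_base span_base[of w])
qed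

lemma bilinear_vec_scale:
  "bilinear (\<lambda>(x :: (real, 'n::finite) vec) (w :: 'w::real_vector). \<chi> \<sigma>. (x $ \<sigma>) *\<^sub>R w)"
  by (simp add: bilinear_def linear_iff vec_eq_iff algebra_simps)

text \<open>The map comes from the universal property and has an explicit inverse. That
  \<open>G\<close> is a left inverse, and that the actions are intertwined, need checking only on
  pure tensors, since these span.\<close>

lemma rep_iso_tensor_right_reg:
  obtains \<Phi> :: "((real, 's::{finite, monoid_mult}) vec, 'w::real_vector) tensor \<Rightarrow> ('w, 's) vec"
  where "rep_iso tensor_right_reg UNIV right_reg UNIV \<Phi>"
    and "\<And>x w. \<Phi> (x \<otimes> w) = (\<chi> \<sigma>. (x $ \<sigma>) *\<^sub>R w)"
proof -
  define \<Phi> :: "((real, 's) vec, 'w) tensor \<Rightarrow> ('w, 's) vec" where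
    "\<Phi> = tensor_lift (\<lambda>x w. \<chi> \<sigma>. (x $ \<sigma>) *\<^sub>R w)"
  \<comment> \<open>The inverse of \<open>\<Phi>\<close>: a family is rebuilt from its entries by
    tensoring each with the matching standard basis vector.\<close>
  define G :: "('w, 's) vec \<Rightarrow> ((real, 's) vec, 'w) tensor" where
    "G v = (\<Sum>\<sigma>\<in>UNIV. axis \<sigma> 1 \<otimes> v $ \<sigma>)" for v
  have lin: "linear \<Phi>" and pure: "\<Phi> (x \<otimes> w) = (\<chi> \<sigma>. (x $ \<sigma>) *\<^sub>R w)" for x w
    unfolding \<Phi>_def by (rule tensor_lift[OF bilinear_vec_scale])+
  have linG: "linear G"
    by (simp add: G_def linear_iff sum.distrib scaleR_sum_right
        bilinear_radd[OF bilinear_pure_tensor] bilinear_rmul[OF bilinear_pure_tensor])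
  have "\<Phi> (G v) = v" for v
    by (simp add: G_def linear_sum[OF lin] pure vec_eq_iff axis_def if_distrib[of "\<lambda>a. a *\<^sub>R _"]
        cong: if_cong)
  moreover have "G (\<Phi> t) = t" for t
  proof -
    have "G (\<Phi> (x \<otimes> w)) = x \<otimes> w" for x w
    proof -
      have "G (\<Phi> (x \<otimes> w)) = (\<Sum>\<sigma>\<in>UNIV. (x $ \<sigma> *\<^sub>R axis \<sigma> 1) \<otimes> w)"
        by (simp add: G_def pure bilinear_rmul[OF bilinear_pure_tensor]
            bilinear_lmul[OF bilinear_pure_tensor])
      also have "\<dots> = (\<Sum>\<sigma>\<in>UNIV. x $ \<sigma> *\<^sub>R axis \<sigma> 1) \<otimes> w"
        by (rule linear_sum[OF linear_pure_tensor_left, symmetric])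
      also have "(\<Sum>\<sigma>\<in>UNIV. x $ \<sigma> *\<^sub>R axis \<sigma> 1) = x"
        by (simp add: vec_eq_iff axis_def if_distrib cong: if_cong)
      finally show ?thesis .
    qed
    then show ?thesis
      using tensor_linear_eqI[OF linear_compose[OF lin linG] linear_id] by (auto simp: o_def)
  qed
  ultimately have "bij \<Phi>" by (metis o_bij[of G \<Phi>] ext comp_apply id_apply)
  moreover have "\<Phi> (tensor_right_reg \<sigma> t) = right_reg \<sigma> (\<Phi> t)" for \<sigma> t
    using tensor_linear_eqI[OF linear_compose[OF linear_tensor_right_reg lin]
        linear_compose[OF lin linear_right_reg]]
    by (auto simp: o_def tensor_right_reg_pure pure right_reg_def)
  ultimately have "rep_iso tensor_right_reg UNIV right_reg UNIV \<Phi>"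
    by (simp add: rep_iso_def subrep_def linear_add[OF lin] linear_scale[OF lin])
  then show ?thesis using pure by (rule that)
qed

text \<open>The action is the identity on the second factor, so
  \<open>y \<mapsto> y \<otimes> w\<close> is equivariant. Injectivity is left as a hypothesis; for
  basis vectors the coordinate maps supply it.\<close>

lemma rep_iso_pure_tensor_line:
  fixes Y :: "((real, 's::{finite, monoid_mult}) vec) set"
  assumes Y: "subrep right_reg Y" and inj: "inj_on (\<lambda>y. y \<otimes> w) Y"
  shows "rep_iso right_reg Y tensor_right_reg (tensor_sub Y (span {w})) (\<lambda>y. y \<otimes> w)"
proof -
  have sub: "subspace Y" using Y by (simp add: subrep_def)
  have "subspace (tensor_sub Y (span {w}))"
    by (simp add: tensor_sub_def)
  moreover have "tensor_right_reg \<sigma> t \<in> tensor_sub Y (span {w})"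
    if "t \<in> tensor_sub Y (span {w})" for \<sigma> t
    using that Y by (auto simp: tensor_sub_line[OF sub] tensor_right_reg_pure subrep_def)
  moreover have "bij_betw (\<lambda>y. y \<otimes> w) Y (tensor_sub Y (span {w}))"
    using inj by (simp add: bij_betw_def tensor_sub_line[OF sub])
  ultimately show ?thesis
    using Y by (simp add: rep_iso_def subrep_def tensor_right_reg_pure
        bilinear_ladd[OF bilinear_pure_tensor] bilinear_lmul[OF bilinear_pure_tensor])
qed

text \<open>
  \<open>C j\<close> is \<open>1 \<otimes> b\<^sub>j\<^sup>*\<close> for the dual basis \<open>b\<^sub>j\<^sup>*\<close>; the last property is what makes it commute
  with \<open>f \<otimes> 1\<close> for every linear \<open>f\<close>.
\<close>

lemma tensor_coordinates:
  fixes b :: "'j \<Rightarrow> 'w::real_vector"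
  assumes fin: "finite J" and inj: "inj_on b J" and indep: "independent (b ` J)"
    and span: "span (b ` J) = UNIV"
  obtains C :: "'j \<Rightarrow> ('v::real_vector, 'w) tensor \<Rightarrow> 'v"
  where "\<And>j. linear (C j)"
    and "\<And>j k x. j \<in> J \<Longrightarrow> k \<in> J \<Longrightarrow> C j (x \<otimes> b k) = (if j = k then x else 0)"
    and "\<And>t. (\<Sum>j\<in>J. C j t \<otimes> b j) = t"
    and "\<And>j x w. \<exists>c. C j (x \<otimes> w) = c *\<^sub>R x \<and> (\<forall>x'. C j (x' \<otimes> w) = c *\<^sub>R x')"
proof -
  \<comment> \<open>\<open>c j\<close> is the dual basis functional; its linearity on the whole
    space uses that the basis spans.\<close>
  define c where "c j w = representation (b ` J) w (b j)" for j w
  have lin_c: "linear (c j)" for j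
    by (rule linearI)
      (simp_all add: c_def representation_add representation_scale indep span)
  have c_b: "c j (b k) = (if j = k then 1 else 0)" if "j \<in> J" "k \<in> J" for j k
    using that inj by (auto simp: c_def representation_basis indep inj_on_eq_iff)
  have sum_c: "(\<Sum>j\<in>J. c j w *\<^sub>R b j) = w" for w
    using sum_representation_eq[OF indep, of w "b ` J"] fin span
    by (simp add: c_def sum.reindex[OF inj])
  have bil: "bilinear (\<lambda>(x::'v) w. c j w *\<^sub>R x)" for j
    by (simp add: bilinear_def linear_iff linear_add[OF lin_c] linear_scale[OF lin_c]
        algebra_simps)
  define C :: "'j \<Rightarrow> ('v, 'w) tensor \<Rightarrow> 'v" where
    "C j = tensor_lift (\<lambda>x w. c j w *\<^sub>R x)" for j
  have lin: "linear (C j)" and pure: "C j (x \<otimes> w) = c j w *\<^sub>R x" for j x w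
    unfolding C_def by (rule tensor_lift[OF bil])+
  have "(\<Sum>j\<in>J. C j t \<otimes> b j) = t" for t
  proof -
    have "linear (\<lambda>t. \<Sum>j\<in>J. C j t \<otimes> b j)"
      by (intro linear_compose_sum ballI)
        (use linear_compose[OF lin linear_pure_tensor_left] in \<open>simp add: o_def\<close>)
    moreover have "(\<Sum>j\<in>J. C j (x \<otimes> w) \<otimes> b j) = x \<otimes> w" for x w
    proof -
      have "(\<Sum>j\<in>J. C j (x \<otimes> w) \<otimes> b j) = (\<Sum>j\<in>J. x \<otimes> (c j w *\<^sub>R b j))"
        by (simp add: pure bilinear_lmul[OF bilinear_pure_tensor]
            bilinear_rmul[OF bilinear_pure_tensor])
      then show ?thesis
        by (simp add: linear_sum[OF linear_pure_tensor_right, symmetric] sum_c)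
    qed
    ultimately show ?thesis
      using tensor_linear_eqI[OF _ linear_id] by auto
  qed
  then show ?thesis
    by (intro that[of C] lin) (auto simp: pure c_b)
qed


section \<open>External direct sums\<close>

lemma lookup_scaleR:
  "Poly_Mapping.lookup (c *\<^sub>R p) k = c *\<^sub>R Poly_Mapping.lookup p k"
  by (simp add: scaleR_poly_mapping_def)

lemma mem_external_direct_sum:
  "f \<in> external_direct_sum I U \<longleftrightarrow>
     (\<forall>i\<in>I. Poly_Mapping.lookup f i \<in> U i) \<and> (\<forall>i. i \<notin> I \<longrightarrow> Poly_Mapping.lookup f i = 0)"
  unfolding external_direct_sum_def by (auto simp: subset_iff in_keys_iff)

lemma subspace_external_direct_sum:
  assumes "\<And>i. i \<in> I \<Longrightarrow> subspace (U i)"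
  shows "subspace (external_direct_sum I U)"
  unfolding subspace_def
  using assms
  by (auto simp: mem_external_direct_sum subspace_0 lookup_add subspace_add lookup_scaleR
      subspace_scale)

text \<open>\<open>Poly_Mapping.map\<close> keeps zero entries at zero whatever the mapped function
  does there, hence the condition on \<open>\<rho> \<sigma> 0\<close>.\<close>

lemma lookup_sum_rep:
  assumes "\<rho> \<sigma> 0 = 0"
  shows "Poly_Mapping.lookup (sum_rep \<rho> \<sigma> f) i = \<rho> \<sigma> (Poly_Mapping.lookup f i)"
  using assms by (simp add: sum_rep_def map.rep_eq when_def)

text \<open>This discharges the zero condition of \<open>lookup_sum_rep\<close> when
  \<open>sum_rep\<close> is iterated.\<close>

lemma sum_rep_zero: "sum_rep \<rho> \<sigma> 0 = 0"
  by (rule poly_mapping_eqI) (simp add: sum_rep_def map.rep_eq)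

lemma subrep_external_direct_sum:
  assumes "\<And>i. i \<in> I \<Longrightarrow> subrep \<rho> (U i)" and "\<And>\<sigma>. \<rho> \<sigma> 0 = 0"
  shows "subrep (sum_rep \<rho>) (external_direct_sum I U)"
proof -
  have "subspace (external_direct_sum I U)"
    by (rule subspace_external_direct_sum) (use assms(1) in \<open>auto simp: subrep_def\<close>)
  moreover have "sum_rep \<rho> \<sigma> f \<in> external_direct_sum I U"
    if "f \<in> external_direct_sum I U" for \<sigma> f
    using that assms(1)
    by (simp add: mem_external_direct_sum subrep_def lookup_sum_rep assms(2))
  ultimately show ?thesis by (simp add: subrep_def)
qed

lemma lookup_sum_single:
  assumes "finite I"
  shows "Poly_Mapping.lookup (\<Sum>i\<in>I. Poly_Mapping.single i (u i)) k = (if k \<in> I then u k else 0)"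
  using assms by (simp add: lookup_sum lookup_single when_def)

text \<open>The nested finitely supported functions keep the two sums apart, with outer index
  \<open>i\<close> and inner index \<open>j\<close>. The last clause makes the final isomorphism
  respect the decompositions summand by summand.\<close>

theorem theorem2p9:
  fixes b :: "nat \<Rightarrow> 'w::real_vector"
    and Y :: "nat \<Rightarrow> ((real, 's::{finite, monoid_mult}) vec) set"
    and d s :: nat
  assumes basis_inj: "inj_on b {1..d}"
    and basis_indep: "independent (b ` {1..d})"
    and basis_span: "span (b ` {1..d}) = UNIV"
    and decomp: "internal_direct_sum {1..s} Y UNIV"
    and indec: "\<forall>i\<in>{1..s}. indecomposable right_reg (Y i)"
  shows
    "(\<exists>\<Phi> :: ((real, 's) vec, 'w) tensor \<Rightarrow> ('w, 's) vec.
        rep_iso tensor_right_reg UNIV right_reg UNIV \<Phi> \<and>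
        (\<forall>x w. \<Phi> (x \<otimes> w) = (\<chi> \<sigma>. (x $ \<sigma>) *\<^sub>R w)))
   \<and> internal_direct_sum ({1..s} \<times> {1..d})
        (\<lambda>(i, j). tensor_sub (Y i) (span {b j})) (UNIV :: ((real, 's) vec, 'w) tensor set)
   \<and> (\<forall>i\<in>{1..s}. \<forall>j\<in>{1..d}.
        indecomposable tensor_right_reg (tensor_sub (Y i) (span {b j})))
   \<and> (\<exists>\<Psi> :: ((real, 's) vec, 'w) tensor \<Rightarrow> nat \<Rightarrow>\<^sub>0 nat \<Rightarrow>\<^sub>0 (real, 's) vec.
        rep_iso tensor_right_reg UNIV
          (sum_rep (sum_rep right_reg)) (external_direct_sum {1..s} (\<lambda>i. power_space d (Y i))) \<Psi> \<and>
        (\<forall>i\<in>{1..s}. \<forall>j\<in>{1..d}.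
          \<Psi> ` tensor_sub (Y i) (span {b j})
            = (\<lambda>y. Poly_Mapping.single i (Poly_Mapping.single j y)) ` Y i))"
proof -
  define I J where "I = {1..s}" and "J = {1..d}"
  have fin: "finite I" "finite J" by (simp_all add: I_def J_def)
  note hyps = basis_inj[folded J_def] basis_indep[folded J_def] basis_span[folded J_def]
    decomp[folded I_def] indec[folded I_def]
  let ?T = "\<lambda>i j. tensor_sub (Y i) (span {b j})"

  \<comment> \<open>Equivariant coordinates and projections\<close>
  obtain C :: "nat \<Rightarrow> ((real, 's) vec, 'w) tensor \<Rightarrow> (real, 's) vec" where
    lin_C: "\<And>j. linear (C j)"
    and C_b: "\<And>j k x. j \<in> J \<Longrightarrow> k \<in> J \<Longrightarrow> C j (x \<otimes> b k) = (if j = k then x else 0)"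
    and sum_C: "\<And>t. (\<Sum>j\<in>J. C j t \<otimes> b j) = t"
    and C_scale: "\<And>j x w. \<exists>c. C j (x \<otimes> w) = c *\<^sub>R x \<and> (\<forall>x'. C j (x' \<otimes> w) = c *\<^sub>R x')"
    by (rule tensor_coordinates[OF fin(2) hyps(1-3)]) blast
  have C_act: "C j (tensor_right_reg \<sigma> t) = right_reg \<sigma> (C j t)" for j \<sigma> t
  proof -
    \<comment> \<open>On pure tensors \<open>C j\<close> scales the first factor by a number
      depending only on \<open>j\<close> and \<open>w\<close>, and linear maps commute with
      scaling.\<close>
    have "C j (right_reg \<sigma> x \<otimes> w) = right_reg \<sigma> (C j (x \<otimes> w))" for x w
      using C_scale[of j x w] by (auto simp: linear_scale[OF linear_right_reg])
    then show ?thesis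
      using tensor_linear_eqI[OF linear_compose[OF linear_tensor_right_reg lin_C]
          linear_compose[OF lin_C linear_right_reg]]
      by (auto simp: o_def tensor_right_reg_pure)
  qed
  have rep_Y: "subrep right_reg (Y i)" if "i \<in> I" for i
    using hyps(5) that by (simp add: indecomposable_def)
  then have sub_Y: "subspace (Y i)" if "i \<in> I" for i
    using that by (simp add: subrep_def)
  obtain P where P: "projection_family I Y P"
    using internal_direct_sum_projections[OF hyps(4) fin(1)] by blast
  have lin_P: "linear (P i)" and P_mem: "P i x \<in> Y i" if "i \<in> I" for i x
    using P that by (auto simp: projection_family_def)
  have sum_P: "(\<Sum>i\<in>I. P i x) = x" for x
    using P by (simp add: projection_family_def)
  have P_Y: "P i y = (if i = k then y else 0)" if "i \<in> I" "k \<in> I" "y \<in> Y k" for i k y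
    using P that by (simp add: projection_family_def)
  have P_act: "P i (right_reg \<sigma> x) = right_reg \<sigma> (P i x)" if "i \<in> I" for i \<sigma> x
    by (rule projection_family_commute[OF P fin(1) linear_right_reg])
      (use rep_Y that in \<open>auto simp: subrep_def\<close>)
  have T_eq: "?T i j = (\<lambda>y. y \<otimes> b j) ` Y i" if "i \<in> I" for i j
    by (rule tensor_sub_line[OF sub_Y[OF that]])
  \<comment> \<open>With the sums exchanged, the inner sum over \<open>i\<close> collapses to
    \<open>C j t\<close> by \<open>sum_P\<close>, leaving the basis expansion
    \<open>sum_C\<close>.\<close>
  have sum_PC: "(\<Sum>i\<in>I. \<Sum>j\<in>J. P i (C j t) \<otimes> b j) = t" for t
    by (subst sum.swap)
      (simp add: linear_sum[OF linear_pure_tensor_left, symmetric] sum_P sum_C)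

  \<comment> \<open>Identification with the vector-valued regular representation\<close>
  have Phi: "\<exists>\<Phi> :: ((real, 's) vec, 'w) tensor \<Rightarrow> ('w, 's) vec.
      rep_iso tensor_right_reg UNIV right_reg UNIV \<Phi> \<and>
      (\<forall>x w. \<Phi> (x \<otimes> w) = (\<chi> \<sigma>. (x $ \<sigma>) *\<^sub>R w))"
    using rep_iso_tensor_right_reg by metis

  \<comment> \<open>Internal decomposition of the tensor product\<close>
  have sum: "internal_direct_sum (I \<times> J) (\<lambda>(i, j). ?T i j) UNIV"
  proof (rule projection_family_internal_direct_sum)
    have lin: "linear (\<lambda>t. P i (C j t) \<otimes> b j)" if "i \<in> I" for i j
      using linear_compose[OF linear_compose[OF lin_C lin_P[OF that]] linear_pure_tensor_left]
      by (simp add: o_def)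
    \<comment> \<open>A member of the summand \<open>(k, l)\<close> is
      \<open>y \<otimes> b l\<close> with \<open>y\<close> in \<open>Y k\<close>. So
      \<open>C j\<close> selects \<open>j = l\<close>, then \<open>P i\<close> selects
      \<open>i = k\<close>; if \<open>j \<noteq> l\<close>, \<open>P i\<close> is applied to
      0.\<close>
    have delta: "P i (C j t) \<otimes> b j = (if (i, j) = (k, l) then t else 0)"
      if ij: "i \<in> I" "j \<in> J" "k \<in> I" "l \<in> J" and t: "t \<in> ?T k l" for i j k l t
    proof -
      obtain y where y: "y \<in> Y k" "t = y \<otimes> b l"
        using t unfolding T_eq[OF ij(3)] by blast
      have "P i 0 = 0" by (rule linear_0[OF lin_P[OF ij(1)]])
      then show ?thesis
        using ij y by (auto simp: C_b P_Y linear_0[OF linear_pure_tensor_left])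
    qed
    show "projection_family (I \<times> J) (\<lambda>(i, j). ?T i j) (\<lambda>(i, j) t. P i (C j t) \<otimes> b j)"
      unfolding projection_family_def
    proof (intro conjI ballI allI)
      show "(\<Sum>p\<in>I \<times> J. (case p of (i, j) \<Rightarrow> \<lambda>t. P i (C j t) \<otimes> b j) t) = t" for t
        using sum_PC[of t] by (simp add: sum.cartesian_product split_def)
      fix p q t
      assume "p \<in> I \<times> J" "q \<in> I \<times> J" "t \<in> (case q of (i, j) \<Rightarrow> ?T i j)"
      moreover obtain i j k l where "p = (i, j)" "q = (k, l)" by (metis surj_pair)
      ultimately show "(case p of (i, j) \<Rightarrow> \<lambda>t. P i (C j t) \<otimes> b j) t = (if p = q then t else 0)"
        using delta[of i j k l t] by simp
    qed (use lin T_eq P_mem in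
        \<open>auto simp: tensor_sub_def\<close>)
  qed (use fin in simp)

  \<comment> \<open>Indecomposability of the summands\<close>
  have inj_b: "inj_on (\<lambda>y. y \<otimes> b j) (Y i)" if "j \<in> J" for i j
    \<comment> \<open>\<open>C j\<close> is a left inverse of
      \<open>y \<mapsto> y \<otimes> b j\<close>.\<close>
    by (rule inj_onI) (metis C_b that)
  have ind: "indecomposable tensor_right_reg (?T i j)" if "i \<in> I" "j \<in> J" for i j
    using indecomposable_rep_iso[OF rep_iso_pure_tensor_line[OF rep_Y inj_b]] hyps(5) that by blast

  \<comment> \<open>Isomorphism onto the external direct sum\<close>
  note power = power_space_def[of d, folded J_def]
  let ?E = "external_direct_sum I (\<lambda>i. power_space d (Y i))"
  define \<Psi> :: "((real, 's) vec, 'w) tensor \<Rightarrow> nat \<Rightarrow>\<^sub>0 nat \<Rightarrow>\<^sub>0 (real, 's) vec" where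
    "\<Psi> t = (\<Sum>i\<in>I. Poly_Mapping.single i (\<Sum>j\<in>J. Poly_Mapping.single j (P i (C j t))))" for t
  have lookup_Psi: "Poly_Mapping.lookup (Poly_Mapping.lookup (\<Psi> t) i) j =
      (if i \<in> I \<and> j \<in> J then P i (C j t) else 0)" for t i j
    by (simp add: \<Psi>_def lookup_sum_single fin)
  have eqI: "f = g"
    if "\<And>i j. Poly_Mapping.lookup (Poly_Mapping.lookup f i) j =
      Poly_Mapping.lookup (Poly_Mapping.lookup g i) j" for f g :: "nat \<Rightarrow>\<^sub>0 nat \<Rightarrow>\<^sub>0 (real, 's) vec"
    using that by (intro poly_mapping_eqI)
  \<comment> \<open>The inverse of \<open>\<Psi>\<close> on \<open>?E\<close>. It reads only the
    slots in \<open>I \<times> J\<close>, so it can invert \<open>\<Psi>\<close> only where all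
    other slots vanish.\<close>
  define G :: "(nat \<Rightarrow>\<^sub>0 nat \<Rightarrow>\<^sub>0 (real, 's) vec) \<Rightarrow> ((real, 's) vec, 'w) tensor" where
    "G f = (\<Sum>i\<in>I. \<Sum>j\<in>J. Poly_Mapping.lookup (Poly_Mapping.lookup f i) j \<otimes> b j)" for f
  \<comment> \<open>This formula serves twice: it shows that \<open>G\<close> is a right inverse on
    \<open>?E\<close>, and it computes the image of each summand.\<close>
  have Psi_b: "\<Psi> (y \<otimes> b j) = Poly_Mapping.single i (Poly_Mapping.single j y)"
    if "i \<in> I" "j \<in> J" "y \<in> Y i" for i j y
  proof (rule eqI)
    show "Poly_Mapping.lookup (Poly_Mapping.lookup (\<Psi> (y \<otimes> b j)) k) l =
      Poly_Mapping.lookup (Poly_Mapping.lookup (Poly_Mapping.single i (Poly_Mapping.single j y)) k) l"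
      for k l
      using that by (auto simp: lookup_Psi lookup_single when_def C_b P_Y linear_0[OF lin_P])
  qed
  have Psi_E: "\<Psi> t \<in> ?E" for t
  proof -
    have "Poly_Mapping.lookup (\<Psi> t) i = 0" if "i \<notin> I" for i
      by (rule poly_mapping_eqI) (use that in \<open>simp add: lookup_Psi\<close>)
    moreover have "Poly_Mapping.lookup (\<Psi> t) i \<in> power_space d (Y i)" if "i \<in> I" for i
      using that P_mem unfolding power external_direct_sum_def
      by (auto simp: in_keys_iff lookup_Psi split: if_splits)
    ultimately show ?thesis
      unfolding external_direct_sum_def by (auto simp: in_keys_iff)
  qed
  have lin_Psi: "linear \<Psi>"
    by (rule linearI; rule eqI)
      (simp_all add: lookup_Psi lookup_add lookup_scaleR linear_add[OF lin_C] linear_add[OF lin_P]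
        linear_scale[OF lin_C] linear_scale[OF lin_P])
  have "G (\<Psi> t) = t" for t
    using sum_PC[of t] by (simp add: G_def lookup_Psi)
  moreover have "\<Psi> (G f) = f" if f: "f \<in> ?E" for f
  proof -
    \<comment> \<open>Membership in \<open>?E\<close> puts each entry in its own \<open>Y i\<close>,
      as \<open>Psi_b\<close> requires.\<close>
    have mem: "Poly_Mapping.lookup (Poly_Mapping.lookup f i) j \<in> Y i" if "i \<in> I" "j \<in> J" for i j
      using f that by (auto simp: external_direct_sum_def power)
    have "\<Psi> (G f) = (\<Sum>i\<in>I. \<Sum>j\<in>J. Poly_Mapping.single i (Poly_Mapping.single j
        (Poly_Mapping.lookup (Poly_Mapping.lookup f i) j)))"
      unfolding G_def linear_sum[OF lin_Psi]
      by (intro sum.cong refl Psi_b mem)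
    also have "\<dots> = f"
    proof (rule eqI)
      \<comment> \<open>The support conditions of the outer and inner sums make \<open>f\<close>
        vanish outside \<open>I \<times> J\<close>, so its slots in \<open>I \<times> J\<close>
        determine it.\<close>
      have out1: "Poly_Mapping.lookup f k = 0" if "k \<notin> I" for k
        using f that by (auto simp: external_direct_sum_def in_keys_iff)
      have out2: "Poly_Mapping.lookup (Poly_Mapping.lookup f k) l = 0" if "k \<in> I" "l \<notin> J" for k l
      proof -
        have "Poly_Mapping.keys (Poly_Mapping.lookup f k) \<subseteq> J"
          using f that(1) by (simp add: external_direct_sum_def power)
        then show ?thesis using that(2) by (meson in_keys_iff subsetD)
      qed
      have "(\<Sum>i\<in>I. \<Sum>j\<in>J. Poly_Mapping.single i (Poly_Mapping.single j
          (Poly_Mapping.lookup (Poly_Mapping.lookup f i) j))) =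
        (\<Sum>i\<in>I. Poly_Mapping.single i (\<Sum>j\<in>J. Poly_Mapping.single j
          (Poly_Mapping.lookup (Poly_Mapping.lookup f i) j)))"
        by (intro sum.cong refl poly_mapping_eqI)
          (simp add: lookup_sum lookup_single when_def)
      then show "Poly_Mapping.lookup (Poly_Mapping.lookup (\<Sum>i\<in>I. \<Sum>j\<in>J. Poly_Mapping.single i
          (Poly_Mapping.single j (Poly_Mapping.lookup (Poly_Mapping.lookup f i) j))) k) l =
        Poly_Mapping.lookup (Poly_Mapping.lookup f k) l" for k l
        using out1 out2 by (simp add: lookup_sum_single fin)
    qed
    finally show ?thesis .
  qed
  ultimately have bij: "bij_betw \<Psi> UNIV ?E"
    by (intro bij_betw_byWitness[of _ G]) (auto intro: Psi_E)
  have reg0: "right_reg \<sigma> 0 = 0" for \<sigma> :: 's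
    by (rule linear_0[OF linear_right_reg])
  have act: "\<Psi> (tensor_right_reg \<sigma> t) = sum_rep (sum_rep right_reg) \<sigma> (\<Psi> t)" for \<sigma> t
    \<comment> \<open>Inside \<open>I \<times> J\<close> this is equivariance of \<open>C j\<close>
      and \<open>P i\<close>; outside, both entries are 0 because the action fixes 0.\<close>
    by (rule eqI)
      (simp add: lookup_Psi lookup_sum_rep sum_rep_zero reg0 C_act P_act)
  have "subrep (sum_rep (sum_rep right_reg)) ?E"
    unfolding power
    by (intro subrep_external_direct_sum rep_Y reg0 sum_rep_zero)
  then have iso: "rep_iso tensor_right_reg UNIV (sum_rep (sum_rep right_reg)) ?E \<Psi>"
    using bij act
    by (simp add: rep_iso_def subrep_def linear_add[OF lin_Psi] linear_scale[OF lin_Psi])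
  have "\<Psi> ` ?T i j = (\<lambda>y. Poly_Mapping.single i (Poly_Mapping.single j y)) ` Y i"
    if "i \<in> I" "j \<in> J" for i j
    using that by (simp add: T_eq image_image Psi_b)
  with iso Phi sum ind show ?thesis
    unfolding I_def[symmetric] J_def[symmetric] by blast
qed

end
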